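(* Let $\rho>0$ and let $g_1\ge g_2>0$ be the effective channel gains of the strong user (user 1) and the weak user (user 2). Let $\alpha_{1'}^2,\alpha_{2'}^2\in[0,1]$ with $\alpha_{1'}^2+\alpha_{2'}^2=1$ be an arbitrary power allocation for OMA, and let the degrees of freedom of OMA be split in the sum-rate-optimal way $$\lambda_k=\frac{\alpha_{k'}^2 g_k}{\alpha_{1'}^2 g_1+\alpha_{2'}^2 g_2},\qquad k\in\{1,2\}.$$ Then there exists a NOMA power allocation $\alpha_1^2$ satisfying $$\frac{\left(1+\frac{\rho\alpha_{1'}^2 g_1}{\lambda_1}\right)^{\lambda_1}-1}{\rho g_1}\;\le\;\alpha_1^2\;\le\;\frac{1+\rho g_2-\left(1+\frac{\rho\alpha_{2'}^2 g_2}{\lambda_2}\right)^{\lambda_2}}{\rho g_2\left(1+\frac{\rho\alpha_{2'}^2 g_2}{\lambda_2}\right)^{\lambda_2}},$$ and every such $\alpha_1^2$ lies in $[0,1]$ and, with $\alpha_2^2=1-\alpha_1^2$, gives each user in NOMA an individual rate at least as large as in OMA, i.e. $$\log_2(1+\rho\alpha_1^2 g_1)\ge \lambda_1\log_2\left(1+\frac{\rho\alpha_{1'}^2 g_1}{\lambda_1}\right),$$ $$\log_2\left(1+\frac{\rho\alpha_2^2 g_2}{1+\rho\alpha_1^2 g_2}\right)\ge\lambda_2\log_2\left(1+\frac{\rho\alpha_{2'}^2 g_2}{\lambda_2}\right).$$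
   Context: Setting: two users in one cluster of a downlink MIMO system; $g_k=|\mathbf v_k^H\mathbf H_k\mathbf p|^2$ is the effective channel gain of user $k$ (with $\mathbf v_k$ the receive beamforming vector, $\mathbf H_k$ the channel matrix, $\mathbf p$ the common transmit beamforming vector), and $\rho>0$ is the inverse noise power. Only the positive numbers $g_1\ge g_2$ and $\rho$ matter. In NOMA with power coefficients $\alpha_1^2+\alpha_2^2=1$, the individual rates are $R_1^{\mathrm{NOMA}}=\log_2(1+\rho\alpha_1^2g_1)$ and $R_2^{\mathrm{NOMA}}=\log_2\left(1+\frac{\rho\alpha_2^2g_2}{1+\rho\alpha_1^2g_2}\right)$. In OMA with power coefficients $\alpha_{1'}^2+\alpha_{2'}^2=1$ and fractions of the degrees of freedom $\lambda_1+\lambda_2=1$, the individual rates are $R_k^{\mathrm{OMA}}=\lambda_k\log_2\left(1+\frac{\rho\alpha_{k'}^2g_k}{\lambda_k}\right)$. Convention: if $\lambda_k=0$ (which happens exactly when $\alpha_{k'}^2=0$), then $R_k^{\mathrm{OMA}}=0$ and $\left(1+\frac{\rho\alpha_{k'}^2 g_k}{\lambda_k}\right)^{\lambda_k}=1$. *)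

theory Defs
  imports Complex_Main
begin

text \<open>
  Power allocations are given by the power shares, i.e. the squared power coefficients
  \<open>\<alpha>\<^sup>2\<close>, so no square appears below. The parameter \<open>g\<close> is an effective channel gain and \<open>\<rho>\<close> the
  inverse noise power. User 1 is the strong user: in NOMA it decodes and removes the signal of
  user 2, whereas user 2 treats the signal of user 1 as noise.
\<close>

definition noma_rate1 :: "real \<Rightarrow> real \<Rightarrow> real \<Rightarrow> real" where
  "noma_rate1 \<rho> p1 g1 = log 2 (1 + \<rho> * p1 * g1)"

definition noma_rate2 :: "real \<Rightarrow> real \<Rightarrow> real \<Rightarrow> real \<Rightarrow> real" where
  "noma_rate2 \<rho> p1 p2 g2 = log 2 (1 + \<rho> * p2 * g2 / (1 + \<rho> * p1 * g2))"

text \<open>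
  The variable \<open>d\<close> is the fraction of the degrees of freedom, usually written \<open>\<lambda>\<close>. By convention,
  for \<open>d = 0\<close> the rate is 0 and the factor \<open>(1 + \<rho> q g / d)\<^sup>d\<close> is 1.
\<close>

definition oma_rate :: "real \<Rightarrow> real \<Rightarrow> real \<Rightarrow> real \<Rightarrow> real" where
  "oma_rate \<rho> d q g = (if d = 0 then 0 else d * log 2 (1 + \<rho> * q * g / d))"

definition oma_factor :: "real \<Rightarrow> real \<Rightarrow> real \<Rightarrow> real \<Rightarrow> real" where
  "oma_factor \<rho> d q g = (if d = 0 then 1 else (1 + \<rho> * q * g / d) powr d)"

end

theory Submission
  imports Defs "HOL-Analysis.Convex"
begin

text \<open>
  With the sum-rate-optimal split both users of OMA see the same value
  \<open>T = 1 + \<rho> (q1 g1 + q2 g2)\<close> inside the logarithm, so the two factors are \<open>T\<^sup>d\<^sup>1\<close> and \<open>T\<^sup>d\<^sup>2\<close>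
  and their product is \<open>T\<close>. Clearing denominators, the nonemptiness of the interval becomes
  \<open>(g1 - g2) T\<^sup>d\<^sup>2 \<le> (g1 - g2) (1 + \<rho> q2 g2)\<close>, which is Bernoulli's inequality
  \<open>T\<^sup>d\<^sup>2 \<le> 1 + d2 (T - 1)\<close>. The rate bounds are the two bounds on \<open>p1\<close>, rewritten.
\<close>

text \<open>Weighted AM-GM for \<open>x\<close> and \<open>1\<close> with weights \<open>d\<close>
  and \<open>1 - d\<close>.\<close>

lemma powr_le_Bernoulli:
  fixes x d :: real
  assumes "x > 0" "0 \<le> d" "d \<le> 1"
  shows "x powr d \<le> 1 + d * (x - 1)"
  using Youngs_inequality_0[of d "1 - d" x 1] assms by (simp add: algebra_simps)

lemma log_oma_factor:
  assumes "1 + \<rho> * q * g / d > 0"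
  shows "log 2 (oma_factor \<rho> d q g) = oma_rate \<rho> d q g"
  using assms by (simp add: oma_factor_def oma_rate_def log_powr)

text \<open>For \<open>d\<close> nonzero, \<open>q * g / d\<close> is \<open>S\<close>. For
  \<open>d = 0\<close> the conventional value 1 agrees with \<open>powr 0\<close> of a positive
  base, so no case split is needed later.\<close>

lemma oma_factor_proportional_split:
  assumes "\<rho> > 0" "S > 0" "d = q * g / S"
  shows "oma_factor \<rho> d q g = (1 + \<rho> * S) powr d"
  using assms by (auto simp: oma_factor_def add_pos_pos less_imp_neq[symmetric])

lemma noma_rate1_ge:
  assumes "\<rho> * g > 0" "F > 0" "(F - 1) / (\<rho> * g) \<le> p"
  shows "log 2 F \<le> noma_rate1 \<rho> p g"
proof -
  have "F \<le> 1 + \<rho> * p * g"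
    using assms by (simp add: pos_divide_le_eq algebra_simps)
  then show ?thesis
    using assms unfolding noma_rate1_def by simp
qed

text \<open>As the shares sum to one, the argument of the logarithm is
  \<open>(1 + \<rho> * g) / (1 + \<rho> * p * g)\<close>. It decreases in \<open>p\<close>, so a
  lower bound on the rate becomes an upper bound on \<open>p\<close>.\<close>

lemma noma_rate2_ge:
  assumes "\<rho> * g > 0" "F > 0" "p \<ge> 0" "p \<le> (1 + \<rho> * g - F) / (\<rho> * g * F)"
  shows "log 2 F \<le> noma_rate2 \<rho> p (1 - p) g"
proof -
  have "p * (\<rho> * g) \<ge> 0"
    using assms by (metis less_imp_le mult_nonneg_nonneg)
  then have pos: "1 + \<rho> * p * g > 0"
    by (simp add: algebra_simps)
  have "p * (\<rho> * g * F) \<le> 1 + \<rho> * g - F"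
    using assms by (simp add: pos_le_divide_eq)
  then have "F \<le> (1 + \<rho> * g) / (1 + \<rho> * p * g)"
    using pos by (simp add: pos_le_divide_eq algebra_simps)
  also have "\<dots> = 1 + \<rho> * (1 - p) * g / (1 + \<rho> * p * g)"
    using pos by (simp add: field_simps)
  finally show ?thesis
    using assms unfolding noma_rate2_def by simp
qed

text \<open>Here \<open>a\<close> and \<open>b\<close> stand for \<open>\<rho> * g1\<close> and
  \<open>\<rho> * g2\<close>. After cross-multiplication \<open>F1\<close> occurs only in
  \<open>F1 * F2\<close>, so \<open>prod\<close> eliminates it and a bound on \<open>F2\<close>
  alone suffices.\<close>

lemma power_share_interval_nonempty:
  fixes a b q1 q2 F1 F2 :: real
  assumes "b > 0" "b \<le> a" "q1 + q2 = 1" "F2 > 0"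
    and prod: "F1 * F2 = 1 + q1 * a + q2 * b"
    and F2_le: "F2 \<le> 1 + q2 * b"
  shows "(F1 - 1) / a \<le> (1 + b - F2) / (b * F2)"
proof -
  have q1: "q1 = 1 - q2"
    using assms by simp
  \<comment> \<open>The order of the gains enters here: it makes the factor \<open>a - b\<close>
    nonnegative.\<close>
  have "(a - b) * F2 \<le> (a - b) * (1 + q2 * b)"
    using F2_le assms by (intro mult_left_mono) auto
  moreover have "(F1 - 1) * (b * F2) = b * (1 + q1 * a + q2 * b) - b * F2"
    unfolding prod[symmetric] by (simp add: algebra_simps)
  ultimately have "(F1 - 1) * (b * F2) \<le> (1 + b - F2) * a"
    by (simp add: q1 algebra_simps)
  then show ?thesis
    using assms by (simp add: divide_le_eq pos_le_divide_eq mult.commute)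
qed

theorem mainTheorem1:
  fixes \<rho> g1 g2 q1 q2 d1 d2 lower upper :: real
  assumes "\<rho> > 0" and "g1 \<ge> g2" and "g2 > 0"
    and "q1 \<in> {0..1}" and "q2 \<in> {0..1}" and "q1 + q2 = 1"
    and "d1 = q1 * g1 / (q1 * g1 + q2 * g2)"
    and "d2 = q2 * g2 / (q1 * g1 + q2 * g2)"
    and "lower = (oma_factor \<rho> d1 q1 g1 - 1) / (\<rho> * g1)"
    and "upper = (1 + \<rho> * g2 - oma_factor \<rho> d2 q2 g2) / (\<rho> * g2 * oma_factor \<rho> d2 q2 g2)"
  shows "(\<exists>p1. lower \<le> p1 \<and> p1 \<le> upper) \<and>
    (\<forall>p1 p2. lower \<le> p1 \<and> p1 \<le> upper \<and> p2 = 1 - p1 \<longrightarrow>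
       p1 \<in> {0..1} \<and>
       noma_rate1 \<rho> p1 g1 \<ge> oma_rate \<rho> d1 q1 g1 \<and>
       noma_rate2 \<rho> p1 p2 g2 \<ge> oma_rate \<rho> d2 q2 g2)"
proof -
  define S T F1 F2 where "S = q1 * g1 + q2 * g2" and "T = 1 + \<rho> * S"
    and "F1 = T powr d1" and "F2 = T powr d2"
  have g1: "g1 > 0" and q: "0 \<le> q1" "0 \<le> q2"
    using assms by auto
  have S: "S > 0"
  proof -
    \<comment> \<open>\<open>S\<close> is a weighted mean of the gains, hence at least the smaller
      one.\<close>
    have "g2 = q1 * g2 + q2 * g2"
      using assms(6) by (metis distrib_right mult_1)
    also have "\<dots> \<le> S"
      unfolding S_def using assms(2) q by (simp add: mult_left_mono)
    finally show ?thesis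
      using assms(3) by simp
  qed
  have d1: "d1 = q1 * g1 / S" and d2: "d2 = q2 * g2 / S"
    using assms(7,8) by (simp_all add: S_def)
  have d0: "d1 \<ge> 0" "d2 \<ge> 0"
    using q g1 assms(3) S by (simp_all add: d1 d2)
  have dsum: "d1 + d2 = 1"
    using S unfolding d1 d2 by (simp add: S_def flip: add_divide_distrib)
  have T: "T > 1"
    using S assms(1) by (simp add: T_def)
  have F_ge1: "F1 \<ge> 1" "F2 \<ge> 1"
    using T d0 by (simp_all add: F1_def F2_def ge_one_powr_ge_zero)
  have fac: "oma_factor \<rho> d1 q1 g1 = F1" "oma_factor \<rho> d2 q2 g2 = F2"
    using oma_factor_proportional_split[OF assms(1) S d1] oma_factor_proportional_split[OF assms(1) S d2]
    by (simp_all add: F1_def F2_def T_def)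
  have rates: "oma_rate \<rho> d1 q1 g1 = log 2 F1" "oma_rate \<rho> d2 q2 g2 = log 2 F2"
    using log_oma_factor[of \<rho> q1 g1 d1] log_oma_factor[of \<rho> q2 g2 d2] fac q g1 d0 assms(1,3)
    by (simp_all add: add_pos_nonneg)
  have a: "\<rho> * g1 > 0" and b: "\<rho> * g2 > 0"
    using assms(1,3) g1 by auto
  have prod: "F1 * F2 = 1 + q1 * (\<rho> * g1) + q2 * (\<rho> * g2)"
    using T by (simp add: F1_def F2_def dsum T_def S_def algebra_simps flip: powr_add)
  have F2_le: "F2 \<le> 1 + q2 * (\<rho> * g2)"
  proof -
    have "F2 \<le> 1 + d2 * (T - 1)"
      unfolding F2_def using T d0 dsum by (intro powr_le_Bernoulli) auto
    \<comment> \<open>The proportional split gives \<open>d2 * S = q2 * g2\<close>.\<close>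
    also have "d2 * (T - 1) = q2 * (\<rho> * g2)"
      using S by (simp add: T_def d2)
    finally show ?thesis .
  qed
  have lower: "lower = (F1 - 1) / (\<rho> * g1)"
    and upper: "upper = (1 + \<rho> * g2 - F2) / (\<rho> * g2 * F2)"
    using assms(9,10) by (simp_all add: fac)
  have "lower \<le> upper"
    unfolding lower upper using a b F_ge1 assms(1,2,6) prod F2_le
    by (intro power_share_interval_nonempty[of _ _ q1 q2]) auto
  moreover have "lower \<ge> 0"
    using a F_ge1 by (simp add: lower)
  moreover have "upper \<le> 1"
  proof -
    \<comment> \<open>With denominators cleared, \<open>upper \<le> 1\<close> is exactly this
      inequality.\<close>
    have "(1 + \<rho> * g2) * 1 \<le> (1 + \<rho> * g2) * F2"
      using b F_ge1 by (intro mult_left_mono) auto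
    then show ?thesis
      using b F_ge1 by (simp add: upper pos_divide_le_eq algebra_simps)
  qed
  moreover have "log 2 F1 \<le> noma_rate1 \<rho> p1 g1" if "lower \<le> p1" for p1
    using noma_rate1_ge[OF a] that F_ge1 by (simp add: lower)
  moreover have "log 2 F2 \<le> noma_rate2 \<rho> p1 (1 - p1) g2" if "0 \<le> p1" "p1 \<le> upper" for p1
    using noma_rate2_ge[OF b] that F_ge1 by (simp add: upper)
  ultimately show ?thesis
    unfolding rates by (auto intro: order_trans)
qed

end
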